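(* Let $n\ge 1$ and $0\le p\le n$ be integers. In the feedback game on the octahedral path $E_n$ with starting vertex $u_p$, the winner is as follows (all congruences modulo $3$): if $n\equiv 0$, Alice wins for every $p$; if $n\equiv 1$, Bob wins when $p\equiv 0$ or $p\equiv 1$, and Alice wins when $p\equiv 2$; if $n\equiv 2$, Bob wins when $p\equiv 1$, and Alice wins when $p\equiv 0$ or $p\equiv 2$.
   Context: The octahedral path $E_n$ ($n\ge1$) is the graph on vertices $u_i,v_i,w_i$ ($0\le i\le n$) whose edges are: $u_iv_i, v_iw_i, w_iu_i$ for $0\le i\le n$, and $u_iu_{i+1}, u_iw_{i+1}, v_iv_{i+1}, v_iu_{i+1}, w_iw_{i+1}, w_iv_{i+1}$ for $0\le i\le n-1$. (It is the Eulerian triangulation of the sphere obtained from the octahedron $E_1$ by repeatedly adding an octahedron inside a face; by symmetry the choice among $u_p,v_p,w_p$ as starting vertex does not matter.) The feedback game on a connected graph $G$ with a starting vertex $s$: a token is placed on $s$; two players, Alice (who moves first) and Bob, alternately move the token from its current vertex $u$ to a vertex $v$ adjacent to $u$, and the edge $uv$ is then deleted. The first player who moves the token back to $s$, or to a vertex that is isolated after deletion of the edge just used, wins. "X wins the game" means X has a winning strategy. *)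

theory Defs
  imports Main "HOL-Number_Theory.Cong"
begin

text \<open>A simple graph without isolated vertices is given by its set of edges, each edge being
  the set of its two endpoints.\<close>

datatype vertex = U nat | V nat | W nat

definition octahedral_path :: "nat \<Rightarrow> vertex set set" where
  "octahedral_path n =
     (\<Union>i\<in>{..n}. {{U i, V i}, {V i, W i}, {W i, U i}}) \<union>
     (\<Union>i\<in>{..<n}. {{U i, U (Suc i)}, {U i, W (Suc i)},
                   {V i, V (Suc i)}, {V i, U (Suc i)},
                   {W i, W (Suc i)}, {W i, V (Suc i)}})"

definition isolated :: "'v set set \<Rightarrow> 'v \<Rightarrow> bool" where
  "isolated E v \<longleftrightarrow> (\<forall>e\<in>E. v \<notin> e)"

text \<open>A (partial) play is recorded as the nonempty list of the positions of the token so far,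
  starting with \<open>s\<close>.\<close>

definition used_edges :: "'v list \<Rightarrow> 'v set set" where
  "used_edges xs = {{xs ! i, xs ! Suc i} |i. Suc i < length xs}"

definition remaining_edges :: "'v set set \<Rightarrow> 'v list \<Rightarrow> 'v set set" where
  "remaining_edges E xs = E - used_edges xs"

definition legal_move :: "'v set set \<Rightarrow> 'v list \<Rightarrow> 'v \<Rightarrow> bool" where
  "legal_move E xs v \<longleftrightarrow> {last xs, v} \<in> remaining_edges E xs"

text \<open>The condition on the length says that at least one move has been made: the token lying
  on \<open>s\<close> initially does not end the game.\<close>

definition finished :: "'v set set \<Rightarrow> 'v \<Rightarrow> 'v list \<Rightarrow> bool" where
  "finished E s xs \<longleftrightarrow>
     2 \<le> length xs \<and> (last xs = s \<or> isolated (remaining_edges E xs) (last xs))"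

inductive play :: "'v set set \<Rightarrow> 'v \<Rightarrow> 'v list \<Rightarrow> bool" for E s where
  start: "play E s [s]"
| move: "play E s xs \<Longrightarrow> \<not> finished E s xs \<Longrightarrow> legal_move E xs v \<Longrightarrow> play E s (xs @ [v])"

datatype player = Alice | Bob

definition to_move :: "'v list \<Rightarrow> player" where
  "to_move xs = (if odd (length xs) then Alice else Bob)"

text \<open>The winner of a finished play is the player who made the last move.\<close>

definition winner :: "'v list \<Rightarrow> player" where
  "winner xs = to_move (butlast xs)"

type_synonym 'v strategy = "'v list \<Rightarrow> 'v"

definition follows :: "player \<Rightarrow> 'v strategy \<Rightarrow> 'v list \<Rightarrow> bool" where
  "follows X \<sigma> xs \<longleftrightarrow>
     (\<forall>k. 0 < k \<and> k < length xs \<and> to_move (take k xs) = X \<longrightarrow> xs ! k = \<sigma> (take k xs))"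

text \<open>When \<open>E\<close> is finite, every play has at most \<open>card E\<close> moves, and an unfinished play can always
  be continued provided that \<open>s\<close> is not isolated in \<open>E\<close>; so under these conditions every
  play in which \<open>X\<close> follows a winning strategy does end, with a win for \<open>X\<close>.\<close>

definition winning_strategy :: "'v set set \<Rightarrow> 'v \<Rightarrow> player \<Rightarrow> 'v strategy \<Rightarrow> bool" where
  "winning_strategy E s X \<sigma> \<longleftrightarrow>
     (\<forall>xs. play E s xs \<and> follows X \<sigma> xs \<longrightarrow>
        (if finished E s xs then winner xs = X
         else to_move xs = X \<longrightarrow> legal_move E xs (\<sigma> xs)))"

definition wins :: "'v set set \<Rightarrow> 'v \<Rightarrow> player \<Rightarrow> bool" where
  "wins E s X \<longleftrightarrow> (\<exists>\<sigma>. winning_strategy E s X \<sigma>)"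

end

theory Submission imports Defs begin

text \<open>The winner always moves into a set \<open>S\<close> that contains the starting vertex \<open>s\<close>, is independent
  (apart from the edge of the first move), and meets the neighbourhood of every other relevant
  vertex in an even number of vertices. Each visit of the opponent to a vertex outside \<open>S\<close> uses one
  of its edges into \<open>S\<close> and the answer uses a second one, so by parity an answer is always available,
  and only the winner ever returns to \<open>s\<close>. Neighbours of \<open>s\<close> other than the first
  vertex \<open>v\<close> need no parity condition: when the opponent moves there, moving to \<open>s\<close> wins. If Bob
  wins, \<open>S\<close> may depend on Alice's first move \<open>v\<close>, which lies outside \<open>S\<close>; if Alice wins, her first
  move \<open>v\<close> lies in \<open>S\<close>.

  In \<open>E\<^sub>n\<close> the sets \<open>S\<close> follow a line of successive antipodes and occupy the layers with the
  pattern 110110...11, which explains the period 3.\<close>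

section \<open>Kernels and the strategy they induce\<close>

definition kernel :: "'v set set \<Rightarrow> 'v \<Rightarrow> 'v \<Rightarrow> 'v set \<Rightarrow> bool" where
  "kernel E s v S \<longleftrightarrow> finite S \<and> s \<in> S \<and> v \<noteq> s \<and> {s, v} \<in> E \<and>
     (\<forall>e\<in>E. e \<subseteq> S \<longrightarrow> e = {s, v}) \<and>
     (\<forall>w. w \<notin> S \<and> (w = v \<or> {s, w} \<notin> E) \<longrightarrow> even (card {y\<in>S. {w, y} \<in> E}))"

text \<open>Returning to \<open>s\<close> takes precedence because a kernel imposes no parity at the
  neighbours of \<open>s\<close> other than \<open>v\<close>.\<close>

definition reply :: "'v set set \<Rightarrow> 'v \<Rightarrow> 'v set \<Rightarrow> 'v list \<Rightarrow> 'v" where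
  "reply E s S xs =
     (if {last xs, s} \<in> remaining_edges E xs then s else (SOME y. y \<in> S \<and> legal_move E xs y))"

section \<open>Effect of one move on plays, edges and parities\<close>

lemma used_edges_snoc:
  assumes "xs \<noteq> []"
  shows "used_edges (xs @ [y]) = insert {last xs, y} (used_edges xs)"
proof -
  have "Suc i < length (xs @ [y]) \<longleftrightarrow> i = length xs - 1 \<or> Suc i < length xs" for i
    using assms by (cases xs) auto
  moreover have "(xs @ [y]) ! (length xs - 1) = last xs" "(xs @ [y]) ! Suc (length xs - 1) = y"
    using assms by (simp_all add: nth_append last_conv_nth)
  moreover have "(xs @ [y]) ! i = xs ! i" "(xs @ [y]) ! Suc i = xs ! Suc i" if "Suc i < length xs" for i
    using that by (simp_all add: nth_append)
  ultimately show ?thesis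
    unfolding used_edges_def by (smt (verit, best) Collect_cong insert_Collect)
qed

lemma remaining_edges_snoc:
  "xs \<noteq> [] \<Longrightarrow> remaining_edges E (xs @ [y]) = remaining_edges E xs - {{last xs, y}}"
  by (auto simp: remaining_edges_def used_edges_snoc)

lemma remaining_edges_single [simp]: "remaining_edges E [s] = E"
  by (simp add: remaining_edges_def used_edges_def)

lemma play_hd: "play E s xs \<Longrightarrow> xs \<noteq> [] \<and> xs ! 0 = s"
  by (induction rule: play.induct) (auto simp: nth_append)

lemma to_move_snoc: "to_move (xs @ [y]) = X \<longleftrightarrow> to_move xs \<noteq> X"
  by (cases X) (auto simp: to_move_def)

lemma follows_snoc:
  "follows X \<sigma> (xs @ [y]) \<longleftrightarrow>
     follows X \<sigma> xs \<and> (xs \<noteq> [] \<and> to_move xs = X \<longrightarrow> y = \<sigma> xs)"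
  unfolding follows_def by (auto simp: nth_append less_Suc_eq)

text \<open>Only an endpoint of the deleted edge loses a neighbour. If \<open>w\<close> is one, it
  lies outside \<open>S\<close>, so the other endpoint lies in \<open>S\<close> and the count drops
  by exactly one.\<close>

lemma even_card_remove_edge:
  assumes "finite S" "w \<notin> S" "a \<in> S \<or> b \<in> S" "a \<noteq> b" "{a, b} \<in> F"
  shows "even (card {y\<in>S. {w, y} \<in> F - {{a, b}}}) \<longleftrightarrow>
     (even (card {y\<in>S. {w, y} \<in> F}) \<longleftrightarrow> w \<noteq> a \<and> w \<noteq> b)"
proof -
  have remove: "even (card (N - {z})) \<longleftrightarrow> odd (card N)" if "z \<in> N" "finite N" for z and N :: "'a set"
    using card_Suc_Diff1[OF that(2,1)] even_Suc by metis
  consider "w = a" | "w = b" | "w \<noteq> a" "w \<noteq> b" by blast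
  then show ?thesis
  proof cases
    case 1
    then have "{y\<in>S. {w, y} \<in> F - {{a, b}}} = {y\<in>S. {w, y} \<in> F} - {b}"
      by (auto simp: doubleton_eq_iff)
    then show ?thesis using 1 assms remove[of b "{y\<in>S. {w, y} \<in> F}"] by auto
  next
    case 2
    then have "{y\<in>S. {w, y} \<in> F - {{a, b}}} = {y\<in>S. {w, y} \<in> F} - {a}"
      by (auto simp: doubleton_eq_iff)
    then show ?thesis using 2 assms remove[of a "{y\<in>S. {w, y} \<in> F}"]
      by (auto simp: insert_commute)
  next
    case 3
    then have "{y\<in>S. {w, y} \<in> F - {{a, b}}} = {y\<in>S. {w, y} \<in> F}"
      by (auto simp: doubleton_eq_iff)
    then show ?thesis using 3 by simp
  qed
qed

section \<open>The invariant of the reply strategy\<close>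

text \<open>The last conjunct holds because \<open>{s, v}\<close> is the only edge at \<open>s\<close> that can be used before the
  game ends.\<close>

definition kernel_invariant ::
  "'v set set \<Rightarrow> 'v \<Rightarrow> 'v \<Rightarrow> 'v set \<Rightarrow> player \<Rightarrow> 'v list \<Rightarrow> bool" where
  "kernel_invariant E s v S X xs \<longleftrightarrow>
     {s, v} \<notin> remaining_edges E xs \<and>
     (last xs \<in> S \<longleftrightarrow> to_move xs \<noteq> X) \<and>
     (\<forall>w. w \<notin> S \<and> (w = v \<or> {s, w} \<notin> E) \<longrightarrow>
        (even (card {y\<in>S. {w, y} \<in> remaining_edges E xs}) \<longleftrightarrow> w \<noteq> last xs)) \<and>
     (last xs \<noteq> s \<longrightarrow> (\<forall>w. w \<noteq> v \<and> {s, w} \<in> E \<longrightarrow> {s, w} \<in> remaining_edges E xs))"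

lemma reply_legal:
  assumes "kernel E s v S" "kernel_invariant E s v S X xs" "to_move xs = X"
  shows "reply E s S xs \<in> S \<and> legal_move E xs (reply E s S xs)"
proof (cases "{last xs, s} \<in> remaining_edges E xs")
  case True
  then show ?thesis using assms by (simp add: reply_def legal_move_def kernel_def)
next
  case False
  have notin: "last xs \<notin> S" "s \<in> S"
    using assms by (auto simp: kernel_invariant_def kernel_def)
  \<comment> \<open>A neighbour of \<open>s\<close> other than \<open>v\<close> would still have its
    edge to \<open>s\<close>, by the last conjunct of the invariant.\<close>
  then have "last xs = v \<or> {s, last xs} \<notin> E"
    using assms(2) False unfolding kernel_invariant_def by (metis insert_commute)
  then have "odd (card {y\<in>S. {last xs, y} \<in> remaining_edges E xs})"
    using assms(2) notin unfolding kernel_invariant_def by blast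
  then have "\<exists>y. y \<in> S \<and> legal_move E xs y"
    unfolding legal_move_def by (metis (mono_tags, lifting) card.empty empty_Collect_eq even_zero)
  from someI_ex[OF this] show ?thesis using False by (simp add: reply_def)
qed

text \<open>Deleting \<open>{s, v}\<close> can change the parity of no vertex outside
  \<open>S\<close> except \<open>v\<close>. If Alice is to win, \<open>v\<close> lies in
  \<open>S\<close>; otherwise \<open>v\<close> turns odd with the token on it, as the invariant
  demands.\<close>

lemma kernel_invariant_start:
  assumes "kernel E s v S" "v \<in> S \<longleftrightarrow> X = Alice"
  shows "kernel_invariant E s v S X [s, v]"
proof -
  have rem: "remaining_edges E [s, v] = E - {{s, v}}"
    using remaining_edges_snoc[of "[s]" E v] by simp
  have "even (card {y\<in>S. {w, y} \<in> E - {{s, v}}}) \<longleftrightarrow> w \<noteq> v"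
    if "w \<notin> S" "w = v \<or> {s, w} \<notin> E" for w
  proof -
    have "even (card {y\<in>S. {w, y} \<in> E})" "w \<noteq> s"
      using assms(1) that unfolding kernel_def by blast+
    then show ?thesis
      using even_card_remove_edge[of S w s v E] assms(1) that(1) by (auto simp: kernel_def)
  qed
  moreover have "v \<in> S \<longleftrightarrow> to_move [s, v] \<noteq> X"
    using assms by (cases X) (auto simp: to_move_def)
  moreover have "{s, w} \<in> E - {{s, v}}" if "v \<noteq> s" "w \<noteq> v" "{s, w} \<in> E" for w
    using that by (auto simp: doubleton_eq_iff)
  moreover have "v \<noteq> s" using assms(1) by (simp add: kernel_def)
  ultimately show ?thesis
    unfolding kernel_invariant_def rem by simp
qed

text \<open>The used edge has exactly one endpoint outside \<open>S\<close>. If parity is controlled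
  there, the count turns even when the token leaves and odd when it arrives.\<close>

lemma kernel_invariant_step:
  assumes kernel: "kernel E s v S" and inv: "kernel_invariant E s v S X xs"
    and "xs \<noteq> []" "last xs \<noteq> s"
    and legal: "legal_move E xs y" and to_S: "to_move xs = X \<Longrightarrow> y \<in> S"
  shows "kernel_invariant E s v S X (xs @ [y])"
proof -
  let ?R = "remaining_edges E xs"
  have edge: "{last xs, y} \<in> ?R" "{last xs, y} \<in> E"
    using legal by (auto simp: legal_move_def remaining_edges_def)
  \<comment> \<open>The opponent cannot stay inside \<open>S\<close>, whose only possible edge
    \<open>{s, v}\<close> is used up.\<close>
  have alternate: "y \<in> S \<longleftrightarrow> last xs \<notin> S"
  proof
    assume "y \<in> S"
    then have "{last xs, y} = {s, v}" if "last xs \<in> S"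
      using that kernel edge by (simp add: kernel_def)
    then show "last xs \<notin> S"
      using edge inv unfolding kernel_invariant_def by metis
  next
    assume "last xs \<notin> S"
    then show "y \<in> S" using to_S inv by (auto simp: kernel_invariant_def)
  qed
  have fin: "finite S" using kernel by (simp add: kernel_def)
  have rem: "remaining_edges E (xs @ [y]) = ?R - {{last xs, y}}"
    using \<open>xs \<noteq> []\<close> by (rule remaining_edges_snoc)
  have "even (card {z\<in>S. {w, z} \<in> ?R - {{last xs, y}}}) \<longleftrightarrow> w \<noteq> y"
    if "w \<notin> S" "w = v \<or> {s, w} \<notin> E" for w
  proof -
    have "even (card {z\<in>S. {w, z} \<in> ?R}) \<longleftrightarrow> w \<noteq> last xs"
      using that inv by (simp add: kernel_invariant_def)
    then show ?thesis
      using even_card_remove_edge[OF fin that(1) _ _ edge(1)] alternate that(1)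
      by (cases "last xs \<in> S") auto
  qed
  moreover have "y \<in> S \<longleftrightarrow> to_move (xs @ [y]) \<noteq> X"
    using alternate inv by (simp add: kernel_invariant_def to_move_snoc)
  \<comment> \<open>The used edge avoids \<open>s\<close> at both ends, so it is none of
    these.\<close>
  moreover have "{s, w} \<in> ?R - {{last xs, y}}" if "y \<noteq> s" "w \<noteq> v" "{s, w} \<in> E" for w
  proof -
    have "{s, w} \<in> ?R"
      using that inv \<open>last xs \<noteq> s\<close> unfolding kernel_invariant_def by blast
    then show ?thesis using that(1) \<open>last xs \<noteq> s\<close> by (auto simp: doubleton_eq_iff)
  qed
  moreover have "{s, v} \<notin> ?R" using inv by (simp add: kernel_invariant_def)
  ultimately show ?thesis
    unfolding kernel_invariant_def rem by simp
qed

text \<open>\<open>M\<close> collects the openings that can occur: the single move \<open>x\<close>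
  when Alice follows the strategy, every neighbour of \<open>s\<close> when Bob does.\<close>

lemma wins_if_kernels:
  fixes S :: "'v \<Rightarrow> 'v set"
  assumes kernel: "\<And>v. v \<in> M \<Longrightarrow> kernel E s v (S v)"
    and side: "\<And>v. v \<in> M \<Longrightarrow> v \<in> S v \<longleftrightarrow> X = Alice"
    and Alice: "X = Alice \<Longrightarrow> M = {x}"
    and Bob: "X = Bob \<Longrightarrow> M = {v. {s, v} \<in> E}"
  shows "wins E s X"
proof -
  \<comment> \<open>Length 1 asks for Alice's opening; afterwards \<open>xs ! 1\<close> records the
    opening and thereby selects the kernel.\<close>
  define \<sigma> where "\<sigma> xs = (if length xs = 1 then x else reply E s (S (xs ! 1)) xs)" for xs :: "'v list"
  have inv: "xs = [s] \<or> 2 \<le> length xs \<and> xs ! 1 \<in> M \<and> kernel_invariant E s (xs ! 1) (S (xs ! 1)) X xs"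
    if "play E s xs" "follows X \<sigma> xs" for xs
    using that
  proof (induction rule: play.induct)
    case start
    then show ?case by simp
  next
    case (move xs y)
    have ne: "xs \<noteq> []" using play_hd[OF move.hyps(1)] by simp
    have fol: "follows X \<sigma> xs" "to_move xs = X \<Longrightarrow> y = \<sigma> xs"
      using move.prems ne unfolding follows_snoc by blast+
    show ?case
    proof (cases "xs = [s]")
      case True
      have "y \<in> M"
      proof (cases X)
        case Alice
        then show ?thesis
          using True fol \<open>X = Alice \<Longrightarrow> M = {x}\<close> by (simp add: to_move_def \<sigma>_def)
      next
        case Bob
        then show ?thesis
          using True move.hyps(3) \<open>X = Bob \<Longrightarrow> M = {v. {s, v} \<in> E}\<close>
          by (simp add: legal_move_def)
      qed
      then show ?thesis
        using True kernel_invariant_start[OF kernel side] by simp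
    next
      case False
      with move.IH fol have *: "2 \<le> length xs" "xs ! 1 \<in> M"
        "kernel_invariant E s (xs ! 1) (S (xs ! 1)) X xs" by auto
      have "last xs \<noteq> s" using move.hyps(2) *(1) by (simp add: finished_def)
      moreover have "y \<in> S (xs ! 1)" if "to_move xs = X"
        using reply_legal[OF kernel *(3)] * that fol by (simp add: \<sigma>_def)
      ultimately show ?thesis
        using kernel_invariant_step[OF kernel[OF *(2)] *(3) ne _ move.hyps(3)] *
        by (simp add: nth_append)
    qed
  qed
  have "if finished E s xs then winner xs = X else to_move xs = X \<longrightarrow> legal_move E xs (\<sigma> xs)"
    if "play E s xs" "follows X \<sigma> xs" for xs
  proof (cases "xs = [s]")
    case True
    have "legal_move E xs (\<sigma> xs)" if "X = Alice"
      using that True kernel[of x] Alice by (simp add: \<sigma>_def legal_move_def kernel_def)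
    then show ?thesis
      using True by (auto simp: finished_def to_move_def)
  next
    case False
    define T where "T = S (xs ! 1)"
    from False inv[OF that] have *: "2 \<le> length xs" "kernel_invariant E s (xs ! 1) T X xs"
      "kernel E s (xs ! 1) T" using kernel by (auto simp: T_def)
    have win: "winner xs = X" if "to_move xs \<noteq> X"
      using that * to_move_snoc[of "butlast xs" "last xs" X] unfolding winner_def
      by (cases xs rule: rev_cases) auto
    have legal: "legal_move E xs (\<sigma> xs)" if "to_move xs = X"
      using reply_legal[OF *(3,2) that] * by (simp add: \<sigma>_def T_def)
    \<comment> \<open>The opponent never ends the game: the token is then outside \<open>S\<close>,
      so not on \<open>s\<close>, and the legal reply shows that its vertex is not isolated.\<close>
    have "\<not> finished E s xs" if "to_move xs = X"
    proof -
      have "last xs \<noteq> s"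
        using * that by (auto simp: kernel_invariant_def kernel_def)
      then show ?thesis
        using legal[OF that] by (auto simp: finished_def isolated_def legal_move_def)
    qed
    then show ?thesis using win legal by auto
  qed
  then show ?thesis unfolding wins_def winning_strategy_def by blast
qed

section \<open>Layers and colours of the octahedral path\<close>

text \<open>The colour classes are the sequences of successive antipodes in the octahedra, so that
  adjacency becomes symmetric in the three colours and under reflection of the path.\<close>

fun layer :: "vertex \<Rightarrow> nat" where
  "layer (U i) = i" | "layer (V i) = i" | "layer (W i) = i"

fun colour :: "vertex \<Rightarrow> nat" where
  "colour (U i) = i mod 3" | "colour (V i) = (i + 2) mod 3" | "colour (W i) = (i + 1) mod 3"

lemma Suc_mod_3:
  fixes i :: nat
  shows "Suc i mod 3 \<noteq> i mod 3" "i mod 3 \<noteq> Suc i mod 3"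
    "Suc (Suc i) mod 3 \<noteq> i mod 3" "i mod 3 \<noteq> Suc (Suc i) mod 3"
    "Suc (Suc (Suc i)) mod 3 = i mod 3"
  by presburger+

text \<open>In the next layer a vertex misses only its antipode, which has the same colour; within a
  layer all colours differ. At layer 0 truncated subtraction makes the window
  \<open>{0..1}\<close>.\<close>

lemma octahedral_path_iff:
  "{a, b} \<in> octahedral_path n \<longleftrightarrow>
     layer a \<le> n \<and> layer b \<le> n \<and> layer b \<in> {layer a - 1..layer a + 1} \<and> colour a \<noteq> colour b"
proof -
  have near: "j \<in> {i - 1..i + 1} \<longleftrightarrow> j = i \<or> j = Suc i \<or> i = Suc j" for i j :: nat
    by auto
  show ?thesis
    unfolding octahedral_path_def near
    by (cases a; cases b; simp add: doubleton_eq_iff bex_disj_distrib; auto simp: Suc_mod_3)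
qed

lemma octahedral_path_edge: "e \<in> octahedral_path n \<Longrightarrow> \<exists>a b. e = {a, b}"
  by (auto simp: octahedral_path_def)

lemma layer_colour_eqD: "layer a = layer b \<Longrightarrow> colour a = colour b \<Longrightarrow> a = b"
  by (cases a; cases b; simp add: Suc_mod_3)

lemma layer_colour_ex:
  assumes "c < 3"
  shows "\<exists>a. layer a = i \<and> colour a = c"
proof -
  have "c = i mod 3 \<or> c = (i + 2) mod 3 \<or> c = (i + 1) mod 3"
    using assms mod_less_divisor[of 3 i] by (simp add: mod_Suc; linarith)
  then have "colour (U i) = c \<or> colour (V i) = c \<or> colour (W i) = c" by auto
  then show ?thesis using layer.simps by blast
qed

section \<open>Kernels built from one colour class\<close>

text \<open>A colour class is independent, so within it only the set \<open>A\<close> of layers has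
  to be chosen.\<close>

definition stripe :: "nat set \<Rightarrow> nat \<Rightarrow> vertex set" where
  "stripe A c = {a. layer a \<in> A \<and> colour a = c}"

lemma bij_betw_layer_stripe:
  assumes "c < 3"
  shows "bij_betw layer (stripe A c) A"
proof (rule bij_betw_imageI)
  show "inj_on layer (stripe A c)"
    by (rule inj_onI) (simp add: stripe_def layer_colour_eqD)
  show "layer ` stripe A c = A"
  proof (intro equalityI subsetI)
    fix i assume "i \<in> A"
    moreover obtain a where "layer a = i" "colour a = c" using layer_colour_ex assms by blast
    ultimately show "i \<in> layer ` stripe A c" by (auto simp: stripe_def)
  qed (auto simp: stripe_def)
qed

lemma card_stripe: "c < 3 \<Longrightarrow> card (stripe A c) = card A"
  by (rule bij_betw_same_card[OF bij_betw_layer_stripe])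

lemma finite_stripe: "c < 3 \<Longrightarrow> finite A \<Longrightarrow> finite (stripe A c)"
  using bij_betw_finite[OF bij_betw_layer_stripe] by simp

text \<open>A vertex of another colour on layer \<open>i\<close> sees exactly the stripe vertices on
  these layers, so the parity condition on vertices becomes one on layers.\<close>

abbreviation even_at :: "nat set \<Rightarrow> nat \<Rightarrow> bool" where
  "even_at A i \<equiv> even (card (A \<inter> {i - 1..i + 1}))"

text \<open>For \<open>i > 0\<close> this is a linear recurrence modulo 2 for membership in
  \<open>A\<close>; its nonzero solutions are the shifts of 110110...\<close>

lemma even_at_iff:
  "even_at A i \<longleftrightarrow> (if i = 0 then 0 \<in> A \<longleftrightarrow> 1 \<in> A
     else (i - 1 \<in> A) = ((i \<in> A) \<noteq> (i + 1 \<in> A)))"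
proof (cases i)
  case 0
  have "{0..Suc 0} = {0, 1}" by auto
  then show ?thesis using 0 by (simp add: Int_insert_right)
next
  case (Suc k)
  have "{k..Suc (Suc k)} = {k, k + 1, k + 2}" by auto
  then show ?thesis using Suc by (simp add: Int_insert_right)
qed

lemma even_stripe_neighbours:
  assumes "c < 3" "A \<subseteq> {..n}" "layer w \<le> n" "colour w \<noteq> c \<Longrightarrow> even_at A (layer w)"
  shows "even (card {y\<in>stripe A c. {w, y} \<in> octahedral_path n})"
proof (cases "colour w = c")
  case True
  then have "{y\<in>stripe A c. {w, y} \<in> octahedral_path n} = {}"
    by (auto simp: octahedral_path_iff stripe_def)
  then show ?thesis by (metis card.empty even_zero)
next
  case False
  then have "{y\<in>stripe A c. {w, y} \<in> octahedral_path n} =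
      stripe (A \<inter> {layer w - 1..layer w + 1}) c"
    using assms by (auto simp: octahedral_path_iff stripe_def)
  then show ?thesis using False assms by (simp add: card_stripe)
qed

text \<open>Used when Bob wins. Layers within distance one of \<open>s\<close>, except that of
  \<open>v\<close>, are exempt: a vertex there is adjacent to \<open>s\<close>, or has the colour of
  \<open>s\<close> and sees nothing of the stripe.\<close>

lemma kernel_stripe:
  assumes "A \<subseteq> {..n}" "layer s \<in> A" "{s, v} \<in> octahedral_path n"
    and even: "\<And>i. i \<le> n \<Longrightarrow> i = layer v \<or> i \<notin> {layer s - 1..layer s + 1} \<Longrightarrow> even_at A i"
  shows "kernel (octahedral_path n) s v (stripe A (colour s))"
proof -
  let ?c = "colour s"
  have c: "?c < 3" by (cases s) auto
  have "even (card {y\<in>stripe A ?c. {w, y} \<in> octahedral_path n})"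
    if "w = v \<or> {s, w} \<notin> octahedral_path n" for w
  proof (cases "layer w \<le> n")
    case True
    show ?thesis
      using c assms(1) True
    proof (rule even_stripe_neighbours)
      assume "colour w \<noteq> ?c"
      then show "even_at A (layer w)"
        using that True assms(1,2) by (intro even) (auto simp: octahedral_path_iff)
    qed
  next
    case False
    then have "{y\<in>stripe A ?c. {w, y} \<in> octahedral_path n} = {}"
      by (auto simp: octahedral_path_iff)
    then show ?thesis by (metis card.empty even_zero)
  qed
  moreover have "\<not> e \<subseteq> stripe A ?c" if "e \<in> octahedral_path n" for e
    using octahedral_path_edge[OF that] that by (auto simp: octahedral_path_iff stripe_def)
  moreover have "finite (stripe A ?c)"
    using c finite_subset[OF assms(1) finite_atMost] by (simp add: finite_stripe)
  moreover have "s \<in> stripe A ?c" using assms(2) by (simp add: stripe_def)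
  moreover have "v \<noteq> s" using assms(3) by (auto simp: octahedral_path_iff)
  ultimately show ?thesis
    using assms(3) unfolding kernel_def by blast
qed

text \<open>Used when Alice wins. By \<open>near\<close>, \<open>v\<close> is the only neighbour of
  \<open>s\<close> in the stripe, so \<open>{s, v}\<close> is the only edge in the set. The layer of
  \<open>s\<close> is exempt because its other vertices are adjacent to \<open>s\<close>.\<close>

lemma kernel_insert_stripe:
  assumes "A \<subseteq> {..n}" "layer s \<le> n" "c < 3" "c \<noteq> colour s" "v \<in> stripe A c"
    and near: "A \<inter> {layer s - 1..layer s + 1} = {layer v}"
    and even: "\<And>i. i \<le> n \<Longrightarrow> i \<noteq> layer s \<Longrightarrow> even_at A i"
  shows "kernel (octahedral_path n) s v (insert s (stripe A c))"
proof -
  have "even (card {y\<in>insert s (stripe A c). {w, y} \<in> octahedral_path n})"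
    if w: "w \<notin> insert s (stripe A c)" "w = v \<or> {s, w} \<notin> octahedral_path n" for w
  proof (cases "layer w \<le> n")
    case True
    have nadj: "{s, w} \<notin> octahedral_path n" using w assms(5) by auto
    then have "{y\<in>insert s (stripe A c). {w, y} \<in> octahedral_path n} =
        {y\<in>stripe A c. {w, y} \<in> octahedral_path n}"
      by (auto simp: insert_commute)
    moreover have "layer w \<noteq> layer s"
      using nadj w assms(2) layer_colour_eqD[of w s] by (auto simp: octahedral_path_iff)
    ultimately show ?thesis
      using even_stripe_neighbours[OF assms(3,1) True] even[OF True] by simp
  next
    case False
    then have "{y\<in>insert s (stripe A c). {w, y} \<in> octahedral_path n} = {}"
      by (auto simp: octahedral_path_iff)
    then show ?thesis by (metis card.empty even_zero)
  qed
  moreover have only: "y = v" if "y \<in> stripe A c" "{s, y} \<in> octahedral_path n" for y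
  proof (rule layer_colour_eqD)
    have "layer y \<in> A \<inter> {layer s - 1..layer s + 1}"
      using that by (simp add: octahedral_path_iff stripe_def)
    then show "layer y = layer v" unfolding near by simp
    show "colour y = colour v"
      using that assms(5) by (simp add: stripe_def)
  qed
  moreover have "e = {s, v}"
    if in_E: "e \<in> octahedral_path n" and subset: "e \<subseteq> insert s (stripe A c)" for e
  proof -
    obtain a b where e: "e = {a, b}" 
      using octahedral_path_edge[OF in_E] by blast
    have "colour a \<noteq> colour b" using in_E e by (simp add: octahedral_path_iff)
    then consider "a = s" "b \<in> stripe A c" | "b = s" "a \<in> stripe A c"
      using subset e by (auto simp: stripe_def)
    then show ?thesis
      using in_E e only by cases (auto simp: insert_commute)
  qed
  moreover have "finite (insert s (stripe A c))"
    using assms(3) finite_subset[OF assms(1) finite_atMost] by (simp add: finite_stripe)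
  moreover have "v \<noteq> s" using assms(4,5) by (auto simp: stripe_def)
  moreover have "{s, v} \<in> octahedral_path n"
  proof -
    have "layer v \<in> A \<inter> {layer s - 1..layer s + 1}" using near by simp
    then have "layer v \<le> n" "layer v \<in> {layer s - 1..layer s + 1}"
      using assms(1) by blast+
    moreover have "colour v = c" using assms(5) by (simp add: stripe_def)
    ultimately show ?thesis
      using assms(2,4) by (simp add: octahedral_path_iff)
  qed
  ultimately show ?thesis unfolding kernel_def by blast
qed

text \<open>The conditions depend on Alice's opening only through its layer
  \<open>r\<close>.\<close>

lemma Bob_wins:
  assumes "\<And>r. r \<in> {layer s - 1..layer s + 1} \<Longrightarrow> r \<le> n \<Longrightarrow> \<exists>A. A \<subseteq> {..n} \<and> layer s \<in> A \<and>
    (\<forall>i\<le>n. i = r \<or> i \<notin> {layer s - 1..layer s + 1} \<longrightarrow> even_at A i)"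
  shows "wins (octahedral_path n) s Bob"
proof -
  let ?M = "{v. {s, v} \<in> octahedral_path n}"
  have "\<exists>S. kernel (octahedral_path n) s v S \<and> v \<notin> S" if "v \<in> ?M" for v
  proof -
    from that have v: "layer v \<in> {layer s - 1..layer s + 1}" "layer v \<le> n" "colour v \<noteq> colour s"
      by (auto simp: octahedral_path_iff)
    from assms[OF v(1,2)] obtain A where "A \<subseteq> {..n}" "layer s \<in> A"
      "\<forall>i\<le>n. i = layer v \<or> i \<notin> {layer s - 1..layer s + 1} \<longrightarrow> even_at A i"
      by blast
    then have "kernel (octahedral_path n) s v (stripe A (colour s))"
      using that by (intro kernel_stripe) auto
    then show ?thesis using v by (auto simp: stripe_def)
  qed
  then obtain S where "\<And>v. v \<in> ?M \<Longrightarrow> kernel (octahedral_path n) s v (S v) \<and> v \<notin> S v"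
    by metis
  then show ?thesis by (intro wins_if_kernels[where M = ?M and S = S]) auto
qed

text \<open>\<open>q\<close> is the layer of Alice's opening vertex, which may have either colour
  different from that of \<open>s\<close>.\<close>

lemma Alice_wins:
  assumes "A \<subseteq> {..n}" "layer s \<le> n" "A \<inter> {layer s - 1..layer s + 1} = {q}"
    and "\<And>i. i \<le> n \<Longrightarrow> i \<noteq> layer s \<Longrightarrow> even_at A i"
  shows "wins (octahedral_path n) s Alice"
proof -
  obtain c where c: "c < 3" "c \<noteq> colour s"
    by (rule that[of "if colour s = 0 then 1 else 0"]) auto
  obtain v where v: "layer v = q" "colour v = c" using layer_colour_ex c by blast
  then have "v \<in> stripe A c" using assms(3) by (auto simp: stripe_def)
  then have "kernel (octahedral_path n) s v (insert s (stripe A c))"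
    using assms c v by (intro kernel_insert_stripe) auto
  then show ?thesis
    using \<open>v \<in> stripe A c\<close>
    by (intro wins_if_kernels[where M = "{v}" and S = "\<lambda>_. insert s (stripe A c)"]) auto
qed

section \<open>The layer pattern 110110...11\<close>

text \<open>The pattern starts at \<open>a\<close> and is cut off at \<open>b\<close>; it ends in a
  full pair 11 when \<open>b - a\<close> is 1 modulo 3.\<close>

definition blocks :: "nat \<Rightarrow> nat \<Rightarrow> nat set" where
  "blocks a b = {j. a \<le> j \<and> j \<le> b \<and> (j - a) mod 3 \<noteq> 2}"

lemma blocks_subset: "blocks a b \<subseteq> {a..b}"
  by (rule subsetI) (simp add: blocks_def)

lemma first_in_blocks: "a \<le> b \<Longrightarrow> a \<in> blocks a b"
  by (simp add: blocks_def)

lemma last_in_blocks: "a \<le> b \<Longrightarrow> (b - a) mod 3 = 1 \<Longrightarrow> b \<in> blocks a b"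
  by (simp add: blocks_def)

lemma nat_less_3_cases: "(k::nat) < 3 \<Longrightarrow> k = 0 \<or> k = 1 \<or> k = 2"
  by auto

text \<open>The two exceptions are the layers just outside the pattern, which see only one element.\<close>

lemma even_at_blocks:
  assumes "a \<le> b" "(b - a) mod 3 = 1" "i + 1 \<noteq> a" "i \<noteq> b + 1"
  shows "even_at (blocks a b) i"
proof (cases "i < a")
  case True
  then have "blocks a b \<inter> {i - 1..i + 1} = {}"
    using assms(3) blocks_subset[of a b] by fastforce
  then show ?thesis by simp
next
  case False
  define d where "d = i - a"
  define e where "e = b - a"
  have i: "i = a + d" using False by (simp add: d_def)
  have b: "b = a + e" using assms(1) by (simp add: e_def)
  have e: "e mod 3 = 1" using assms(2) by (simp only: e_def)
  have shift: "a + j \<in> blocks a b \<longleftrightarrow> j \<le> e \<and> j mod 3 \<noteq> 2" for j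
    by (simp add: blocks_def b)
  show ?thesis
  proof (cases d)
    case 0
    have "1 \<le> e" using e by (cases e) simp_all
    then have "a \<in> blocks a b" "a + 1 \<in> blocks a b"
      using shift[of 0] shift[of 1] by simp_all
    moreover have "a - 1 \<notin> blocks a b" if "a \<noteq> 0"
      using that blocks_subset[of a b] by fastforce
    ultimately show ?thesis unfolding even_at_iff i 0 by (cases "a = 0") simp_all
  next
    case (Suc k)
    have "k \<noteq> e" using assms(4) i b Suc by simp
    have "even_at (blocks a b) i \<longleftrightarrow> (a + k \<in> blocks a b) =
        ((a + Suc k \<in> blocks a b) \<noteq> (a + Suc (Suc k) \<in> blocks a b))"
      unfolding even_at_iff i Suc by simp
    note even_at = this[unfolded shift]
    have residue: "k mod 3 = 0 \<or> k mod 3 = 1 \<or> k mod 3 = 2"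
      by (intro nat_less_3_cases) simp
    \<comment> \<open>First case: all three layers lie beyond \<open>b\<close>. Second:
      \<open>i = b\<close> sees \<open>b - 1\<close> and \<open>b\<close>. Third: three consecutive
      layers inside the pattern contain one gap. The excluded \<open>k = e\<close> is
      \<open>i = b + 1\<close>.\<close>
    consider "e < k" | "e = Suc k" | "Suc (Suc k) \<le> e" using \<open>k \<noteq> e\<close> by linarith
    then show ?thesis
    proof cases
      case 1
      then show ?thesis unfolding even_at by simp
    next
      case 2
      with e have "Suc k mod 3 = 1" by simp
      then have "k mod 3 = 0" using residue by (elim disjE) (simp_all add: mod_Suc)
      then show ?thesis unfolding even_at using 2 by (simp add: mod_Suc)
    next
      case 3
      then have "k \<le> e" "Suc k \<le> e" by simp_all
      with 3 show ?thesis
        unfolding even_at using residue by (elim disjE) (simp_all add: mod_Suc)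
    qed
  qed
qed

section \<open>Patterns for the residues of n and p\<close>

lemma diff_mod_3:
  fixes n p :: nat
  assumes "p \<le> n" "n mod 3 = (p mod 3 + c) mod 3" "c < 3"
  shows "(n - p) mod 3 = c"
proof -
  define d where "d = n - p"
  have "n = p + d" using assms(1) by (simp add: d_def)
  then have "[p + d = p + c] (mod 3)"
    using assms(2) by (simp add: cong_def mod_add_left_eq)
  then have "[d = c] (mod 3)" by (simp only: cong_add_lcancel_nat)
  then show ?thesis using assms(3) by (simp add: cong_def d_def)
qed

text \<open>The pattern fits exactly into the layers \<open>0..n\<close>, its exceptional layers
  fall off the ends, and \<open>p\<close> avoids its gaps. One set serves every opening.\<close>

lemma Bob_wins_1:
  assumes "n mod 3 = 1" "p \<le> n" "p mod 3 \<noteq> 2"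
  shows "wins (octahedral_path n) (U p) Bob"
proof (rule Bob_wins)
  have "even_at (blocks 0 n) i" if "i \<le> n" for i
    using assms(1) that by (intro even_at_blocks) simp_all
  moreover have "p \<in> blocks 0 n" using assms(2,3) by (simp add: blocks_def)
  moreover have "blocks 0 n \<subseteq> {..n}" using blocks_subset[of 0 n] by auto
  ultimately show "\<exists>A. A \<subseteq> {..n} \<and> layer (U p) \<in> A \<and>
      (\<forall>i\<le>n. i = r \<or> i \<notin> {layer (U p) - 1..layer (U p) + 1} \<longrightarrow> even_at A i)" for r
    unfolding layer.simps by blast
qed

text \<open>Both \<open>p\<close> and \<open>n - p\<close> are 1 modulo 3, so the pattern fits on
  \<open>0..p\<close> and on \<open>p..n\<close>. Each fails only at a layer next to
  \<open>p\<close>, which matters only if Alice opens there; so her opening decides the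
  side.\<close>

lemma Bob_wins_2:
  assumes "n mod 3 = 2" "p \<le> n" "p mod 3 = 1"
  shows "wins (octahedral_path n) (U p) Bob"
proof (rule Bob_wins)
  fix r assume r: "r \<in> {layer (U p) - 1..layer (U p) + 1}"
  let ?P = "\<lambda>A. A \<subseteq> {..n} \<and> p \<in> A \<and>
    (\<forall>i\<le>n. i = r \<or> i \<notin> {p - 1..p + 1} \<longrightarrow> even_at A i)"
  have "\<exists>A. ?P A"
  proof (cases "r \<le> p")
    case True
    have "even_at (blocks 0 p) i" if "i \<noteq> p + 1" for i
      using that assms(3) by (intro even_at_blocks) simp_all
    moreover have "i \<noteq> p + 1" if "i = r \<or> i \<notin> {p - 1..p + 1}" for i
      using that True by auto
    moreover have "p \<in> blocks 0 p" using assms(3) by (intro last_in_blocks) simp_all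
    moreover have "blocks 0 p \<subseteq> {..n}" using assms(2) blocks_subset[of 0 p] by fastforce
    ultimately show ?thesis by blast
  next
    case False
    have "(n - p) mod 3 = 1"
      using assms by (intro diff_mod_3) simp_all
    then have "even_at (blocks p n) i" if "i \<le> n" "i + 1 \<noteq> p" for i
      using that assms(2) by (intro even_at_blocks) simp_all
    moreover have "i + 1 \<noteq> p" if "i = r \<or> i \<notin> {p - 1..p + 1}" for i
      using that False by auto
    moreover have "p \<in> blocks p n" using assms(2) by (rule first_in_blocks)
    moreover have "blocks p n \<subseteq> {..n}" using blocks_subset[of p n] by fastforce
    ultimately show ?thesis by blast
  qed
  then show "\<exists>A. A \<subseteq> {..n} \<and> layer (U p) \<in> A \<and>
      (\<forall>i\<le>n. i = r \<or> i \<notin> {layer (U p) - 1..layer (U p) + 1} \<longrightarrow> even_at A i)"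
    unfolding layer.simps .
qed

text \<open>The pattern on \<open>0..p - 1\<close> fails only at \<open>p\<close>, the exempt layer
  of \<open>s\<close>; Alice opens into layer \<open>p - 1\<close>.\<close>

lemma Alice_wins_below:
  assumes "p \<le> n" "p mod 3 = 2"
  shows "wins (octahedral_path n) (U p) Alice"
proof (rule Alice_wins)
  have pos: "1 \<le> p" using assms(2) by (cases p) simp_all
  then have mod: "(p - 1) mod 3 = 1" using assms(2) by (intro diff_mod_3) simp_all
  let ?A = "blocks 0 (p - 1)"
  have A: "?A \<subseteq> {0..p - 1}" by (rule blocks_subset)
  have "p - 1 \<in> ?A" using mod by (intro last_in_blocks) simp_all
  then show "?A \<inter> {layer (U p) - 1..layer (U p) + 1} = {p - 1}"
    using A by fastforce
  have "p - 1 \<le> n" using assms(1) by simp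
  then show "?A \<subseteq> {..n}" using A by fastforce
  show "layer (U p) \<le> n" using assms(1) by simp
  show "even_at ?A i" if "i \<noteq> layer (U p)" for i
    using that pos mod by (intro even_at_blocks) simp_all
qed

text \<open>Mirror image of the preceding case: the pattern on \<open>p + 1..n\<close>, with the
  opening into layer \<open>p + 1\<close>.\<close>

lemma Alice_wins_above:
  assumes "p \<le> n" "(n - p) mod 3 = 2"
  shows "wins (octahedral_path n) (U p) Alice"
proof (rule Alice_wins)
  have pos: "1 \<le> n - p" using assms(2) by (cases "n - p") simp_all
  have "(m - 1) mod 3 = 1" if "m mod 3 = 2" "1 \<le> m" for m :: nat
    using that by (intro diff_mod_3) simp_all
  from this[OF assms(2) pos] have mod: "(n - (p + 1)) mod 3 = 1" by (simp only: diff_diff_left)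
  have less: "p + 1 \<le> n" using pos by linarith
  let ?A = "blocks (p + 1) n"
  have A: "?A \<subseteq> {p + 1..n}" by (rule blocks_subset)
  have "p + 1 \<in> ?A" using less by (rule first_in_blocks)
  then show "?A \<inter> {layer (U p) - 1..layer (U p) + 1} = {p + 1}"
    using A by fastforce
  show "?A \<subseteq> {..n}" using A by fastforce
  show "layer (U p) \<le> n" using assms(1) by simp
  show "even_at ?A i" if "i \<le> n" "i \<noteq> layer (U p)" for i
    using that less mod by (intro even_at_blocks) simp_all
qed

text \<open>Neither one-sided pattern fits. The layers read 110...110 1 011...011 with the single 1
  at \<open>p\<close>; Alice opens within layer \<open>p\<close>, the only one that sees an odd
  number.\<close>

lemma Alice_wins_0:
  assumes "p \<le> n" "n mod 3 = 0" "p mod 3 = 0"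
  shows "wins (octahedral_path n) (U p) Alice"
proof (rule Alice_wins)
  \<comment> \<open>\<open>?L\<close> is a pattern ending at \<open>p + 1\<close> with that layer
    removed, so \<open>even_at_blocks\<close> still serves below \<open>p\<close>; \<open>?R\<close>
    is empty if \<open>p = n\<close>.\<close>
  let ?L = "blocks 0 (p + 1) \<inter> {..p}" and ?R = "blocks (p + 2) n"
  let ?A = "?L \<union> ?R"
  have R: "?R \<subseteq> {p + 2..n}" by (rule blocks_subset)
  have p: "p \<in> ?L" using assms(3) by (simp add: blocks_def)
  show "?A \<subseteq> {..n}" using assms(1) R by fastforce
  show "layer (U p) \<le> n" using assms(1) by simp
  have "p - 1 \<notin> ?A" if "p \<noteq> 0"
  proof -
    have "3 dvd p" using assms(3) by (simp add: dvd_eq_mod_eq_0)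
    then have "3 \<le> p" using that by (simp add: dvd_imp_le)
    then have "(p - 1) mod 3 = 2" using assms(3) by (intro diff_mod_3) simp_all
    then have "p - 1 \<notin> ?L" by (simp add: blocks_def)
    then show ?thesis using R by fastforce
  qed
  \<comment> \<open>The first alternative is \<open>p = 0\<close>, by truncated subtraction.\<close>
  then have "p - 1 = p \<or> p - 1 \<notin> ?A" by (cases "p = 0") simp_all
  moreover have "p + 1 \<notin> ?A" using R by fastforce
  ultimately have "?A \<inter> {p - 1, p, p + 1} = {p}" using p by blast
  moreover have "{p - 1..p + 1} = {p - 1, p, p + 1}" by auto
  ultimately show "?A \<inter> {layer (U p) - 1..layer (U p) + 1} = {p}"
    by (simp only: layer.simps)
  show "even_at ?A i" if "i \<le> n" "i \<noteq> layer (U p)" for i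
  proof -
    have right: "p + 2 \<le> n" "(n - (p + 2)) mod 3 = 1" if "p < n"
    proof -
      have mod: "(n - p) mod 3 = 0" using assms by (intro diff_mod_3) simp_all
      then have "3 dvd n - p" by (simp only: dvd_eq_mod_eq_0)
      then have "3 \<le> n - p" using that by (simp add: dvd_imp_le)
      have "(m - 2) mod 3 = 1" if "m mod 3 = 0" "3 \<le> m" for m :: nat
        using that by (intro diff_mod_3) simp_all
      from this[OF mod \<open>3 \<le> n - p\<close>] show "(n - (p + 2)) mod 3 = 1"
        by (simp only: diff_diff_left)
      show "p + 2 \<le> n" using \<open>3 \<le> n - p\<close> by linarith
    qed
    consider "i < p" | "i = p + 1" | "p + 2 \<le> i" using \<open>i \<noteq> layer (U p)\<close> by force
    then show ?thesis
    proof cases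
      case 1
      then have "{i - 1..i + 1} \<subseteq> {..p}" by auto
      then have "?A \<inter> {i - 1..i + 1} = blocks 0 (p + 1) \<inter> {i - 1..i + 1}"
        using R by fastforce
      moreover have "even_at (blocks 0 (p + 1)) i"
        using 1 assms(3) by (intro even_at_blocks) (simp_all add: mod_Suc)
      ultimately show ?thesis by (simp only:)
    next
      case 2
      \<comment> \<open>Layer \<open>p + 1\<close> is the gap between the single \<open>p\<close>
        and the start of \<open>?R\<close>, so it sees exactly two.\<close>
      then have "p + 2 \<in> ?R" using right(1) \<open>i \<le> n\<close> by (intro first_in_blocks) simp
      moreover have "p + 1 \<notin> ?A" using R by fastforce
      ultimately show ?thesis using 2 p unfolding even_at_iff by simp
    next
      case 3
      then have "{i - 1..i + 1} \<inter> {..p} = {}" by auto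
      then have "?A \<inter> {i - 1..i + 1} = ?R \<inter> {i - 1..i + 1}" by blast
      moreover have "even_at ?R i"
        using 3 right \<open>i \<le> n\<close> by (intro even_at_blocks) simp_all
      ultimately show ?thesis by (simp only:)
    qed
  qed
qed

theorem theorem1p5:
  fixes n p :: nat
  assumes "1 \<le> n" and "p \<le> n"
  shows "([n = 0] (mod 3) \<longrightarrow> wins (octahedral_path n) (U p) Alice) \<and>
    ([n = 1] (mod 3) \<longrightarrow>
       (([p = 0] (mod 3) \<or> [p = 1] (mod 3)) \<longrightarrow> wins (octahedral_path n) (U p) Bob) \<and>
       ([p = 2] (mod 3) \<longrightarrow> wins (octahedral_path n) (U p) Alice)) \<and>
    ([n = 2] (mod 3) \<longrightarrow>
       ([p = 1] (mod 3) \<longrightarrow> wins (octahedral_path n) (U p) Bob) \<and>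
       (([p = 0] (mod 3) \<or> [p = 2] (mod 3)) \<longrightarrow> wins (octahedral_path n) (U p) Alice))"
proof -
  have residue: "p mod 3 = 0 \<or> p mod 3 = 1 \<or> p mod 3 = 2"
    by (intro nat_less_3_cases) simp
  \<comment> \<open>Residue 0 of \<open>p\<close> takes the two-sided pattern, 1 the pattern above
    \<open>p\<close>, 2 the one below.\<close>
  have Alice_0: "wins (octahedral_path n) (U p) Alice" if "n mod 3 = 0"
    using residue
  proof (elim disjE)
    assume "p mod 3 = 0"
    with assms(2) that show ?thesis by (intro Alice_wins_0)
  next
    assume "p mod 3 = 1"
    with assms(2) that have "(n - p) mod 3 = 2" by (intro diff_mod_3) simp_all
    with assms(2) show ?thesis by (rule Alice_wins_above)
  next
    assume "p mod 3 = 2"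
    with assms(2) show ?thesis by (rule Alice_wins_below)
  qed
  have Alice_2: "wins (octahedral_path n) (U p) Alice" if "n mod 3 = 2" "p mod 3 = 0"
  proof -
    have "(n - p) mod 3 = 2" using assms(2) that by (intro diff_mod_3) simp_all
    with assms(2) show ?thesis by (rule Alice_wins_above)
  qed
  have mods: "0 mod 3 = (0::nat)" "1 mod 3 = (1::nat)" "2 mod 3 = (2::nat)" by simp_all
  have neq: "p mod 3 \<noteq> 2" if "p mod 3 = 0 \<or> p mod 3 = 1"
    using that by (elim disjE) simp_all
  show ?thesis
    unfolding cong_def mods
    using Alice_0 Alice_2 Alice_wins_below[OF assms(2)] Bob_wins_1[OF _ assms(2) neq]
      Bob_wins_2[OF _ assms(2)]
    by iprover
qed

end
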